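(* Let $q$ be a prime power and let $k$ be an integer with $(q+5)/10<k<q/8$. Among those functions $g:\mathbb{F}_q\to\mathbb{F}_q$ such that there exists some $f\in RS_k(q)$ with $d(f,g)\le q/2$, the number of those for which a Sudan polynomial $G(x,y)$ for $g$ (as defined in the context) has more than one factor of the form $y-f(x)$ with $f\in\mathbb{F}_q[x]$, $\deg f<k$, is at most $q^{5k+o(q)}$.
   Context: For a prime power $q$ and an integer $1\le k\le q$, the Reed-Solomon code $RS_k(q)$ is the set of functions $\mathbb{F}_q\to\mathbb{F}_q$ represented by a polynomial $f(x)\in\mathbb{F}_q[x]$ with $\deg f<k$. For $g_1,g_2:\mathbb{F}_q\to\mathbb{F}_q$, the Hamming distance is $d(g_1,g_2)=\#\{\alpha\in\mathbb{F}_q\mid g_1(\alpha)\ne g_2(\alpha)\}$. Sudan polynomial for $g$ (a name used here for an output of Sudan's construction): a non-zero polynomial $G(x,y)=a_0(x)+a_1(x)y+a_2(x)y^2+a_3(x)y^3+a_4(x)y^4\in\mathbb{F}_q[x,y]$ with $\deg a_i\le(4-i)(k-1)$ for $i=0,\dots,4$, such that $G(\alpha,g(\alpha))=0$ for all $\alpha\in\mathbb{F}_q$. For $(q+5)/10<k\le q/8$, such a $G$ exists for every $g$, and $G(x,f(x))$ is identically zero for every $f\in RS_k(q)$ with $d(f,g)\le\lfloor q/2\rfloor$. The functions $g$ counted are those for which some Sudan polynomial for $g$ has more than one factor of the stated form. The term $o(q)$ is as $q\to\infty$. *)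

theory Defs
  imports
    "HOL-Algebra.UnivPoly"
    "HOL-Algebra.Divisibility"
    "HOL-Library.FuncSet"
    "HOL-Library.Landau_Symbols"
    "HOL-Number_Theory.Prime_Powers"
begin

text \<open>
  Asymptotic bounds in the field size need a quantifier over all finite fields inside the formula,
  so a field is a \<^locale>\<open>field\<close> structure on a carrier set, not a type of class \<open>field\<close>.
  Over the element type \<open>nat\<close> every finite field occurs up to isomorphism.

  Functions from the field to itself are the elements of \<open>carrier R \<rightarrow>\<^sub>E carrier R\<close>
  (\<open>undefined\<close> off the carrier), so that counting them is meaningful.
  Elements of $R[x]$ and $R[x,y] = R[x][y]$ are the elements of \<open>UP R\<close> and \<open>UP (UP R)\<close>.
  As \<open>deg R\<close> of the zero polynomial is 0, the degree bounds below (which are of the form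
  ``less than $k$'' with $k \ge 1$, or ``at most $d$'') always admit the zero polynomial.
\<close>

definition poly_fun :: "('a, 'm) ring_scheme \<Rightarrow> (nat \<Rightarrow> 'a) \<Rightarrow> 'a \<Rightarrow> 'a" where
  "poly_fun R f = (\<lambda>\<alpha>\<in>carrier R. eval R R id \<alpha> f)"

definition reed_solomon :: "('a, 'm) ring_scheme \<Rightarrow> nat \<Rightarrow> ('a \<Rightarrow> 'a) set" where
  "reed_solomon R k = poly_fun R ` {f \<in> carrier (UP R). deg R f < k}"

definition hamming_dist :: "('a, 'm) ring_scheme \<Rightarrow> ('a \<Rightarrow> 'a) \<Rightarrow> ('a \<Rightarrow> 'a) \<Rightarrow> nat" where
  "hamming_dist R g1 g2 = card {\<alpha> \<in> carrier R. g1 \<alpha> \<noteq> g2 \<alpha>}"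

text \<open>\<open>bieval R \<alpha> \<beta> G\<close> is $G(\alpha,\beta)$: the inner evaluation substitutes \<open>\<alpha>\<close> for $x$
  in the coefficients.\<close>

definition bieval :: "('a, 'm) ring_scheme \<Rightarrow> 'a \<Rightarrow> 'a \<Rightarrow> (nat \<Rightarrow> nat \<Rightarrow> 'a) \<Rightarrow> 'a" where
  "bieval R \<alpha> \<beta> G = eval (UP R) R (eval R R id \<alpha>) \<beta> G"

definition sudan_poly ::
    "('a, 'm) ring_scheme \<Rightarrow> nat \<Rightarrow> ('a \<Rightarrow> 'a) \<Rightarrow> (nat \<Rightarrow> nat \<Rightarrow> 'a) \<Rightarrow> bool" where
  "sudan_poly R k g G \<longleftrightarrow>
     G \<in> carrier (UP (UP R)) \<and> G \<noteq> \<zero>\<^bsub>UP (UP R)\<^esub> \<and> deg (UP R) G \<le> 4 \<and>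
     (\<forall>i\<le>4. deg R (coeff (UP (UP R)) G i) \<le> (4 - i) * (k - 1)) \<and>
     (\<forall>\<alpha>\<in>carrier R. bieval R \<alpha> (g \<alpha>) G = \<zero>\<^bsub>R\<^esub>)"

text \<open>\<open>y_minus R f\<close> is $y - f(x)$.\<close>

definition y_minus :: "('a, 'm) ring_scheme \<Rightarrow> (nat \<Rightarrow> 'a) \<Rightarrow> (nat \<Rightarrow> nat \<Rightarrow> 'a)" where
  "y_minus R f =
     monom (UP (UP R)) \<one>\<^bsub>UP R\<^esub> 1 \<ominus>\<^bsub>UP (UP R)\<^esub> monom (UP (UP R)) f 0"

definition has_multiple_factors ::
    "('a, 'm) ring_scheme \<Rightarrow> nat \<Rightarrow> (nat \<Rightarrow> nat \<Rightarrow> 'a) \<Rightarrow> bool" where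
  "has_multiple_factors R k G \<longleftrightarrow>
     (\<exists>f1\<in>carrier (UP R). \<exists>f2\<in>carrier (UP R).
        f1 \<noteq> f2 \<and> deg R f1 < k \<and> deg R f2 < k \<and>
        y_minus R f1 divides\<^bsub>UP (UP R)\<^esub> G \<and> y_minus R f2 divides\<^bsub>UP (UP R)\<^esub> G)"

end

theory Submission
  imports Defs "HOL-Algebra.Multiplicative_Group" "HOL-Real_Asymp.Real_Asymp"
begin

text \<open>
  Two distinct factors $y - f_1$, $y - f_2$ of $G$ leave a non-zero cofactor
  $H = h_0(x) + h_1(x)y + h_2 y^2$ with $\deg h_i \le (2-i)(k-1)$. Let $Z$ be the set of common
  zeros of the $h_i$. Outside $Z$ the value $g(\alpha)$ is one of at most four roots of
  $G(\alpha,y)$; on $Z$ it is arbitrary, but $h_0$ vanishes there, so each of the $|Z|$ free values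
  of $g$ is paid for by one of the $2k-1$ degrees of freedom of $h_0$. Hence $G$ and $g|_Z$ together
  contribute at most $2^q q^{k+k+k+1+(2k-1)}$ possibilities, and $g$ has at most
  $8^q q^{5k} = q^{5k + q \ln 8/\ln q}$.
\<close>

section \<open>Linear polynomials: products and evaluation\<close>

text \<open>Solved for the coefficient of \<open>Q\<close> at \<open>n\<close>, this is synthetic
  division by a monic linear polynomial: it computes the quotient from its top coefficient
  downwards.\<close>

lemma (in UP_cring) coeff_linear_mult:
  assumes a: "a \<in> carrier R" and Q: "Q \<in> carrier P"
  shows "coeff P ((monom P \<one> 1 \<ominus>\<^bsub>P\<^esub> monom P a 0) \<otimes>\<^bsub>P\<^esub> Q) (Suc n) = coeff P Q n \<ominus> a \<otimes> coeff P Q (Suc n)"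
proof -
  have "(monom P \<one> 1 \<ominus>\<^bsub>P\<^esub> monom P a 0) \<otimes>\<^bsub>P\<^esub> Q = monom P \<one> 1 \<otimes>\<^bsub>P\<^esub> Q \<ominus>\<^bsub>P\<^esub> a \<odot>\<^bsub>P\<^esub> Q"
    using a Q by (simp add: P.minus_eq P.l_distr P.l_minus monom_mult_is_smult)
  moreover have "coeff P (monom P \<one> 1 \<otimes>\<^bsub>P\<^esub> Q) (Suc n) = coeff P Q n"
    using coeff_monom_mult[OF R.one_closed Q, of 1 n] Q by simp
  ultimately show ?thesis
    using a Q by (simp del: coeff_mult)
qed

lemma (in UP_pre_univ_prop) eval_eq_finsum:
  assumes p: "p \<in> carrier P" and s: "s \<in> carrier S" and n: "deg R p \<le> n"
  shows "eval R S h s p = (\<Oplus>\<^bsub>S\<^esub>i\<in>{..n}. h (coeff P p i) \<otimes>\<^bsub>S\<^esub> s [^]\<^bsub>S\<^esub> i)"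
  unfolding eval_on_carrier[OF p]
  by (rule S.add.finprod_mono_neutral_cong) (use p s n in \<open>auto simp: deg_aboveD\<close>)

lemma (in UP_pre_univ_prop) eval_linear:
  assumes a: "a \<in> carrier R" and s: "s \<in> carrier S"
  shows "eval R S h s (monom P \<one> 1 \<ominus>\<^bsub>P\<^esub> monom P a 0) = s \<ominus>\<^bsub>S\<^esub> h a"
proof -
  interpret E: ring_hom_cring P S "eval R S h s"
    by (rule ring_hom_cringI) (use UP_cring S.is_cring eval_ring_hom[OF s] in auto)
  show ?thesis
    using a s eval_monom1[OF s] eval_const[OF s a] by (simp add: P.minus_eq S.minus_eq)
qed

section \<open>Division by two distinct linear factors\<close>

context UP_domain
begin

text \<open>Divide by the first factor and substitute \<open>b\<close> for the variable. The product
  vanishes because of the second factor, while the first factor takes the non-zero value b - a, so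
  the quotient \<open>Q\<close> has the root \<open>b\<close> and the remainder theorem splits off
  the second factor. Only integrality is used, so this also applies when the coefficient ring is
  R[x].\<close>

lemma linear_factors_divide:
  assumes ab: "a \<in> carrier R" "b \<in> carrier R" "a \<noteq> b"
    and Gc: "G \<in> carrier P"
    and da: "(monom P \<one> 1 \<ominus>\<^bsub>P\<^esub> monom P a 0) divides\<^bsub>P\<^esub> G"
    and db: "(monom P \<one> 1 \<ominus>\<^bsub>P\<^esub> monom P b 0) divides\<^bsub>P\<^esub> G"
  obtains H where "H \<in> carrier P"
    "G = (monom P \<one> 1 \<ominus>\<^bsub>P\<^esub> monom P a 0) \<otimes>\<^bsub>P\<^esub> ((monom P \<one> 1 \<ominus>\<^bsub>P\<^esub> monom P b 0) \<otimes>\<^bsub>P\<^esub> H)"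
proof -
  let ?L = "\<lambda>a. monom P \<one> 1 \<ominus>\<^bsub>P\<^esub> monom P a 0"
  have L: "?L c \<in> carrier P" if "c \<in> carrier R" for c
    using that by simp
  interpret U: UP_pre_univ_prop R R id P
    by standard simp
  interpret E: ring_hom_cring P R "eval R R id b"
    by (rule ring_hom_cringI) (use UP_cring R.is_cring U.eval_ring_hom[OF ab(2)] in auto)
  obtain Q where Q: "Q \<in> carrier P" "G = ?L a \<otimes>\<^bsub>P\<^esub> Q"
    using da by (auto elim: dividesE)
  obtain Q' where Q': "Q' \<in> carrier P" "G = ?L b \<otimes>\<^bsub>P\<^esub> Q'"
    using db by (auto elim: dividesE)
  have "eval R R id b G = \<zero>"
    unfolding Q'(2) E.hom_mult[OF L[OF ab(2)] Q'(1)] U.eval_linear[OF ab(2) ab(2)]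
    using Q'(1) ab(2) by (simp add: R.minus_eq R.r_neg)
  moreover have "eval R R id b G = (b \<ominus> a) \<otimes> eval R R id b Q"
    unfolding Q(2) E.hom_mult[OF L[OF ab(1)] Q(1)] U.eval_linear[OF ab(1) ab(2)]
    by simp
  moreover have "b \<ominus> a \<noteq> \<zero>"
    using ab by auto
  ultimately have Q0: "eval R R id b Q = \<zero>"
    using R.integral[of "b \<ominus> a" "eval R R id b Q"] R.minus_closed[OF ab(2,1)] E.hom_closed[OF Q(1)]
    by metis
  have "carrier R \<noteq> {\<zero>}"
    using R.one_not_zero R.one_closed by blast
  then obtain H where H: "H \<in> carrier P" "Q = ?L b \<otimes>\<^bsub>P\<^esub> H \<oplus>\<^bsub>P\<^esub> monom P (eval R R id b Q) 0"
    using remainder_theorem[OF Q(1) ab(2)] by blast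
  then have "Q = ?L b \<otimes>\<^bsub>P\<^esub> H"
    unfolding Q0 monom_zero using P.r_zero[OF P.m_closed[OF L[OF ab(2)] H(1)]] by simp
  then show ?thesis
    using that Q H(1) by blast
qed

section \<open>Bivariate polynomials as polynomials in y over R[x]\<close>

interpretation PP: UP_domain P "UP P"
  by unfold_locales simp_all

lemma y_minus_closed [simp]: "f \<in> carrier P \<Longrightarrow> y_minus R f \<in> carrier (UP P)"
  by (simp add: y_minus_def P_def[symmetric] del: One_nat_def)

text \<open>Give x weight 1 and y weight \<open>d\<close>. The product has weighted degree at most
  (m + 1)d, and dividing by y - f lowers this bound by \<open>d\<close>. Writing G for the product,
  the coefficients of the quotient satisfy q_m = G_{m+1} and q_i = G_{i+1} + f q_{i+1}.\<close>

lemma quotient_weighted_degree: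
  assumes f: "f \<in> carrier P" "deg R f \<le> d" and Q: "Q \<in> carrier (UP P)"
    and deg_le: "deg P (y_minus R f \<otimes>\<^bsub>UP P\<^esub> Q) \<le> Suc m"
    and wdeg: "\<And>i. i \<le> Suc m \<Longrightarrow> deg R (coeff (UP P) (y_minus R f \<otimes>\<^bsub>UP P\<^esub> Q) i) \<le> (Suc m - i) * d"
  shows "deg P Q \<le> m" and "i \<le> m \<Longrightarrow> deg R (coeff (UP P) Q i) \<le> (m - i) * d"
proof -
  let ?G = "y_minus R f \<otimes>\<^bsub>UP P\<^esub> Q"
  have G: "?G \<in> carrier (UP P)"
    using f Q by simp
  have q: "coeff (UP P) Q i \<in> carrier P" for i
    using Q by simp
  have c: "coeff (UP P) ?G (Suc i) = coeff (UP P) Q i \<ominus>\<^bsub>P\<^esub> f \<otimes>\<^bsub>P\<^esub> coeff (UP P) Q (Suc i)" for i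
    using PP.coeff_linear_mult[OF f(1) Q] by (simp only: y_minus_def P_def)
  show *: "deg P Q \<le> m"
  proof (rule ccontr)
    assume "\<not> ?thesis"
    then have m: "m < deg P Q" by simp
    \<comment> \<open>Since y - f is monic in y, the leading coefficient of \<open>Q\<close>
      reappears in the product one index higher. There the product has no coefficient left.\<close>
    then have "coeff (UP P) ?G (Suc (deg P Q)) = \<zero>\<^bsub>P\<^esub>"
      using PP.deg_aboveD[OF _ G] deg_le by simp
    then have "coeff (UP P) Q (deg P Q) = \<zero>\<^bsub>P\<^esub>"
      using c[of "deg P Q"] PP.deg_aboveD[OF _ Q, of "Suc (deg P Q)"] q f
      by (simp add: P.minus_eq)
    then show False
      using m PP.lcoeff_nonzero_deg[OF _ Q] by simp
  qed
  show "deg R (coeff (UP P) Q i) \<le> (m - i) * d" if "i \<le> m"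
    using that
  \<comment> \<open>The induction runs downwards from \<open>m\<close>, in the order in which the
    recursion produces the coefficients.\<close>
  proof (induction i rule: inc_induct)
    case base
    have "coeff (UP P) Q (Suc m) = \<zero>\<^bsub>P\<^esub>"
      using PP.deg_aboveD[OF _ Q] * by simp
    then have "coeff (UP P) Q m = coeff (UP P) ?G (Suc m)"
      using c[of m] q f by (simp add: P.minus_eq)
    then show ?case
      using wdeg[of "Suc m"] by simp
  next
    case (step i)
    have "coeff (UP P) Q i = coeff (UP P) ?G (Suc i) \<oplus>\<^bsub>P\<^esub> f \<otimes>\<^bsub>P\<^esub> coeff (UP P) Q (Suc i)"
      using c[of i] q[of i] q[of "Suc i"] f by (simp add: P.minus_eq P.a_assoc P.l_neg)
    moreover have "deg R (coeff (UP P) ?G (Suc i)) \<le> (m - i) * d"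
      using wdeg[of "Suc i"] step by simp
    moreover have "deg R (f \<otimes>\<^bsub>P\<^esub> coeff (UP P) Q (Suc i)) \<le> d + (m - Suc i) * d"
      using deg_mult_ring[OF f(1) q[of "Suc i"]] f(2) step by linarith
    moreover have "d + (m - Suc i) * d = (m - i) * d"
      using step by (metis Suc_diff_Suc mult_Suc)
    ultimately show ?case
      using deg_add[OF PP.coeff_closed[OF G, of "Suc i"] P.m_closed[OF f(1) q[of "Suc i"]]] by simp
  qed
qed

lemma bieval_hom:
  assumes "\<alpha> \<in> carrier R" "\<beta> \<in> carrier R"
  shows "ring_hom_cring (UP P) R (bieval R \<alpha> \<beta>)"
    and "f \<in> carrier P \<Longrightarrow> bieval R \<alpha> \<beta> (y_minus R f) = \<beta> \<ominus> eval R R id \<alpha> f"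
    and "G \<in> carrier (UP P) \<Longrightarrow> deg P G \<le> n \<Longrightarrow>
      bieval R \<alpha> \<beta> G = (\<Oplus>i\<in>{..n}. eval R R id \<alpha> (coeff (UP P) G i) \<otimes> \<beta> [^] i)"
proof -
  interpret U: UP_pre_univ_prop R R id P
    by standard simp
  interpret E: UP_pre_univ_prop P R "eval R R id \<alpha>" "UP P"
    by (rule UP_pre_univ_propI) (use UP_cring R.is_cring U.eval_ring_hom[OF assms(1)] in auto)
  show "ring_hom_cring (UP P) R (bieval R \<alpha> \<beta>)"
    using ring_hom_cringI[OF PP.UP_cring R.is_cring E.eval_ring_hom[OF assms(2)]]
    by (simp add: bieval_def[abs_def] P_def)
  show "bieval R \<alpha> \<beta> (y_minus R f) = \<beta> \<ominus> eval R R id \<alpha> f" if "f \<in> carrier P"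
    using E.eval_linear[OF that assms(2)] by (simp only: bieval_def y_minus_def P_def)
  show "bieval R \<alpha> \<beta> G = (\<Oplus>i\<in>{..n}. eval R R id \<alpha> (coeff (UP P) G i) \<otimes> \<beta> [^] i)"
    if "G \<in> carrier (UP P)" "deg P G \<le> n"
    using E.eval_eq_finsum[OF that(1) assms(2) that(2)] by (simp add: bieval_def P_def)
qed

section \<open>Counting polynomials and their roots\<close>

lemma card_deg_less:
  assumes "finite (carrier R)"
  shows "finite {f \<in> carrier P. deg R f < n}"
    and "card {f \<in> carrier P. deg R f < n} \<le> card (carrier R) ^ n"
proof -
  let ?L = "{f \<in> carrier P. deg R f < n}" and ?T = "{..<n} \<rightarrow>\<^sub>E carrier R"
  let ?c = "\<lambda>f. restrict (coeff P f) {..<n}"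
  have inj: "inj_on ?c ?L"
  proof (rule inj_onI)
    fix f g assume fg: "f \<in> ?L" "g \<in> ?L" and eq: "?c f = ?c g"
    have "coeff P f i = coeff P g i" for i
    proof (cases "i < n")
      case True
      then show ?thesis using fun_cong[OF eq, of i] by simp
    next
      case False
      then show ?thesis using fg deg_aboveD[of f i] deg_aboveD[of g i] by simp
    qed
    then show "f = g" using fg by (auto intro: up_eqI)
  qed
  have sub: "?c ` ?L \<subseteq> ?T"
    by (rule image_subsetI) (simp add: restrict_PiE_iff)
  have T: "finite ?T" "card ?T = card (carrier R) ^ n"
    using assms by (auto intro: finite_PiE simp: card_PiE)
  show "finite ?L" using inj_on_finite[OF inj sub T(1)] .
  show "card ?L \<le> card (carrier R) ^ n" using card_inj_on_le[OF inj sub T(1)] T(2) by simp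
qed

text \<open>The difference would be a non-zero polynomial with more roots than its degree. This is
  what makes an encoding by values at sufficiently many points decodable.\<close>

lemma eq_if_agree_on_many:
  assumes fin: "finite (carrier R)"
    and f: "f \<in> carrier P" "deg R f < card W" and g: "g \<in> carrier P" "deg R g < card W"
    and W: "W \<subseteq> carrier R" "\<And>x. x \<in> W \<Longrightarrow> eval R R id x f = eval R R id x g"
  shows "f = g"
proof (rule ccontr)
  assume "f \<noteq> g"
  then have nz: "f \<ominus>\<^bsub>P\<^esub> g \<noteq> \<zero>\<^bsub>P\<^esub>" using f g by auto
  interpret U: UP_pre_univ_prop R R id P by standard simp
  let ?Z = "{x \<in> carrier R. eval R R id x (f \<ominus>\<^bsub>P\<^esub> g) = \<zero>}"
  have "W \<subseteq> ?Z"
  proof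
    fix x assume x: "x \<in> W"
    then have xc: "x \<in> carrier R" using W by auto
    interpret E: ring_hom_cring P R "eval R R id x"
      by (rule ring_hom_cringI) (use UP_cring R.is_cring U.eval_ring_hom[OF xc] in auto)
    have "eval R R id x (f \<ominus>\<^bsub>P\<^esub> g) = eval R R id x f \<ominus> eval R R id x g"
      using f g by (simp add: P.minus_eq R.minus_eq)
    then show "x \<in> ?Z" using W(2)[OF x] xc g E.hom_closed[OF g(1)] by (simp add: R.minus_eq R.r_neg)
  qed
  moreover have "finite ?Z \<and> card ?Z \<le> deg R (f \<ominus>\<^bsub>P\<^esub> g)"
    using roots_bound[OF _ nz fin] f g by simp
  moreover have "deg R (f \<ominus>\<^bsub>P\<^esub> g) < card W"
    using deg_add[of f "\<ominus>\<^bsub>P\<^esub> g"] f g by (simp add: P.minus_eq)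
  ultimately show False
    using card_mono[of ?Z W] by linarith
qed

lemma eval_zero_poly: "x \<in> carrier R \<Longrightarrow> eval R R id x \<zero>\<^bsub>P\<^esub> = \<zero>"
  by (simp add: eval_on_carrier)

lemma eval_in_carrier:
  assumes "x \<in> carrier R" "f \<in> carrier P"
  shows "eval R R id x f \<in> carrier R"
  using assms by (auto simp: eval_on_carrier intro!: R.finsum_closed)

text \<open>Substituting \<alpha> for x turns \<open>H\<close> into a univariate polynomial in y of
  degree at most \<open>n\<close>. The coefficient at \<open>i\<close> witnesses that it is
  non-zero, so it has at most \<open>n\<close> roots.\<close>

lemma card_bieval_roots:
  assumes fin: "finite (carrier R)" and \<alpha>: "\<alpha> \<in> carrier R"
    and H: "H \<in> carrier (UP P)" "deg P H \<le> n"
    and i: "eval R R id \<alpha> (coeff (UP P) H i) \<noteq> \<zero>"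
  shows "card {\<beta> \<in> carrier R. bieval R \<alpha> \<beta> H = \<zero>} \<le> n"
proof -
  interpret U: UP_pre_univ_prop R R id P by standard simp
  \<comment> \<open>This is H(\<alpha>, y). Elements of \<open>UP R\<close> are coefficient
    sequences themselves, so the sequence of evaluated coefficients is already the
    polynomial.\<close>
  define p where "p = (\<lambda>i. eval R R id \<alpha> (coeff (UP P) H i))"
  have p0: "p m = \<zero>" if "n < m" for m
    using PP.deg_aboveD[OF _ H(1), of m] H(2) that \<alpha> by (simp add: p_def eval_zero_poly)
  have pc: "p m \<in> carrier R" for m
    unfolding p_def by (rule eval_in_carrier[OF \<alpha> PP.coeff_closed[OF H(1)]])
  have "p \<in> up R"
    using pc p0 by (auto intro!: mem_upI exI[of _ n] bound.intro)
  then have p: "p \<in> carrier P" and cp: "coeff P p = p"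
    by (simp_all add: P_def UP_def)
  have dp: "deg R p \<le> n"
    using p p0 cp by (intro deg_aboveI) auto
  have "p \<noteq> \<zero>\<^bsub>P\<^esub>"
    using i fun_cong[OF cp, of i] coeff_zero[of i] by (auto simp: p_def)
  then have "card {\<beta> \<in> carrier R. eval R R id \<beta> p = \<zero>} \<le> n"
    using roots_bound[OF p _ fin] dp by auto
  moreover have "bieval R \<alpha> \<beta> H = eval R R id \<beta> p" if "\<beta> \<in> carrier R" for \<beta>
    using U.eval_eq_finsum[OF p that dp] bieval_hom(3)[OF \<alpha> that H] cp by (simp add: p_def)
  ultimately show ?thesis
    by (simp cong: conj_cong)
qed

section \<open>Cofactors and the points where they vanish identically in y\<close>

text \<open>For d = k - 1 this is the shape left after two factors are removed from a Sudan
  polynomial: with y of weight \<open>d\<close>, the weighted degree drops from 4d to 2d.\<close>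

definition cofactors :: "nat \<Rightarrow> (nat \<Rightarrow> nat \<Rightarrow> 'a) set" where
  "cofactors d = {H \<in> carrier (UP P). H \<noteq> \<zero>\<^bsub>UP P\<^esub> \<and> deg P H \<le> 2 \<and>
     (\<forall>i\<le>2. deg R (coeff (UP P) H i) \<le> (2 - i) * d)}"

text \<open>These are the \<alpha> for which H(\<alpha>, y) is the zero polynomial, so that
  \<open>H\<close> puts no restriction on the value of g at \<alpha>.\<close>

definition common_zeros :: "(nat \<Rightarrow> nat \<Rightarrow> 'a) \<Rightarrow> 'a set" where
  "common_zeros H = {\<alpha> \<in> carrier R. \<forall>i. eval R R id \<alpha> (coeff (UP P) H i) = \<zero>}"

text \<open>Removing the two factors one after the other lowers the weighted degree from 4(k - 1) to
  3(k - 1) and then to 2(k - 1). Evaluation at (\<alpha>, g(\<alpha>)) is a ring homomorphism into a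
  domain, so one of the three factors of \<open>G\<close> must vanish there.\<close>

lemma sudan_poly_cofactor:
  assumes S: "sudan_poly R k g G" and M: "has_multiple_factors R k G"
  obtains f1 f2 H where "f1 \<in> carrier P" "deg R f1 < k" "f2 \<in> carrier P" "deg R f2 < k"
    "H \<in> cofactors (k - 1)"
    "\<And>\<alpha>. \<alpha> \<in> carrier R \<Longrightarrow> g \<alpha> \<in> carrier R \<Longrightarrow>
       g \<alpha> = eval R R id \<alpha> f1 \<or> g \<alpha> = eval R R id \<alpha> f2 \<or> bieval R \<alpha> (g \<alpha>) H = \<zero>"
proof -
  \<comment> \<open>The bound 4 is written as \<open>Suc 3\<close> to match the \<open>Suc m\<close>
    of \<open>quotient_weighted_degree\<close>; the second division likewise starts from
    \<open>Suc 2\<close>.\<close>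
  have G: "G \<in> carrier (UP P)" "G \<noteq> \<zero>\<^bsub>UP P\<^esub>" "deg P G \<le> Suc 3"
    "\<And>i. i \<le> Suc 3 \<Longrightarrow> deg R (coeff (UP P) G i) \<le> (Suc 3 - i) * (k - 1)"
    and Gz: "\<And>\<alpha>. \<alpha> \<in> carrier R \<Longrightarrow> bieval R \<alpha> (g \<alpha>) G = \<zero>"
    using S by (simp_all add: sudan_poly_def P_def)
  obtain f1 f2 where f: "f1 \<in> carrier P" "f2 \<in> carrier P" "f1 \<noteq> f2" "deg R f1 < k" "deg R f2 < k"
    and dv: "y_minus R f1 divides\<^bsub>UP P\<^esub> G" "y_minus R f2 divides\<^bsub>UP P\<^esub> G"
    using M unfolding has_multiple_factors_def P_def by blast
  from f(4,5) have f': "deg R f1 \<le> k - 1" "deg R f2 \<le> k - 1" by simp_all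
  obtain H where H: "H \<in> carrier (UP P)"
    and GH: "G = y_minus R f1 \<otimes>\<^bsub>UP P\<^esub> (y_minus R f2 \<otimes>\<^bsub>UP P\<^esub> H)"
    using PP.linear_factors_divide[OF f(1-3) G(1)] dv
    unfolding y_minus_def P_def by metis
  let ?Q = "y_minus R f2 \<otimes>\<^bsub>UP P\<^esub> H"
  have Q: "?Q \<in> carrier (UP P)"
    using H f by simp
  have degQ: "deg P ?Q \<le> Suc 2" "\<And>i. i \<le> Suc 2 \<Longrightarrow> deg R (coeff (UP P) ?Q i) \<le> (Suc 2 - i) * (k - 1)"
    using quotient_weighted_degree[OF f(1) f'(1) Q G(3,4)[unfolded GH]] by (simp_all add: numeral_eq_Suc)
  have degH: "deg P H \<le> 2" "\<And>i. i \<le> 2 \<Longrightarrow> deg R (coeff (UP P) H i) \<le> (2 - i) * (k - 1)"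
    using quotient_weighted_degree[OF f(2) f'(2) H degQ] by simp_all
  have "H \<noteq> \<zero>\<^bsub>UP P\<^esub>"
    using G(2) GH f by auto
  then have Hc: "H \<in> cofactors (k - 1)"
    using H degH by (simp add: cofactors_def)
  have "g \<alpha> = eval R R id \<alpha> f1 \<or> g \<alpha> = eval R R id \<alpha> f2 \<or> bieval R \<alpha> (g \<alpha>) H = \<zero>"
    if \<alpha>: "\<alpha> \<in> carrier R" "g \<alpha> \<in> carrier R" for \<alpha>
  proof -
    interpret B: ring_hom_cring "UP P" R "bieval R \<alpha> (g \<alpha>)"
      by (rule bieval_hom(1)[OF \<alpha>])
    have e: "eval R R id \<alpha> f1 \<in> carrier R" "eval R R id \<alpha> f2 \<in> carrier R"
      using eval_in_carrier[OF \<alpha>(1)] f by auto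
    have "\<zero> = (g \<alpha> \<ominus> eval R R id \<alpha> f1) \<otimes> ((g \<alpha> \<ominus> eval R R id \<alpha> f2) \<otimes> bieval R \<alpha> (g \<alpha>) H)"
      using Gz[OF \<alpha>(1)] unfolding GH B.hom_mult[OF y_minus_closed[OF f(1)] Q]
        B.hom_mult[OF y_minus_closed[OF f(2)] H] bieval_hom(2)[OF \<alpha> f(1)] bieval_hom(2)[OF \<alpha> f(2)]
      by simp
    then have "g \<alpha> \<ominus> eval R R id \<alpha> f1 = \<zero> \<or> g \<alpha> \<ominus> eval R R id \<alpha> f2 = \<zero> \<or> bieval R \<alpha> (g \<alpha>) H = \<zero>"
      using R.integral_iff R.minus_closed[OF \<alpha>(2) e(1)] R.minus_closed[OF \<alpha>(2) e(2)]
        R.m_closed[OF R.minus_closed[OF \<alpha>(2) e(2)] B.hom_closed[OF H]] B.hom_closed[OF H]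
      by metis
    then show ?thesis
      using R.r_right_minus_eq[OF \<alpha>(2) e(1)] R.r_right_minus_eq[OF \<alpha>(2) e(2)] by blast
  qed
  with f Hc that show ?thesis by blast
qed

lemma coeff_cofactor_0: "H \<in> cofactors d \<Longrightarrow> 2 < i \<Longrightarrow> coeff (UP P) H i = \<zero>\<^bsub>P\<^esub>"
  using PP.deg_aboveD[of H i] by (simp add: cofactors_def)

text \<open>The common zeros lie among the roots of any single non-zero coefficient of
  \<open>H\<close>, and every coefficient has degree at most 2d.\<close>

lemma card_common_zeros:
  assumes fin: "finite (carrier R)" and H: "H \<in> cofactors d"
  shows "card (common_zeros H) \<le> 2 * d"
proof -
  have Hc: "H \<in> carrier (UP P)" and Hn: "H \<noteq> \<zero>\<^bsub>UP P\<^esub>"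
    using H by (simp_all add: cofactors_def)
  obtain i where i: "coeff (UP P) H i \<noteq> \<zero>\<^bsub>P\<^esub>"
    using PP.lcoeff_nonzero[OF Hn Hc] by blast
  have i2: "i \<le> 2" using i coeff_cofactor_0[OF H, of i] by (meson not_le)
  let ?Z = "{\<alpha> \<in> carrier R. eval R R id \<alpha> (coeff (UP P) H i) = \<zero>}"
  have Z: "finite ?Z" "card ?Z \<le> deg R (coeff (UP P) H i)"
    using roots_bound[OF PP.coeff_closed[OF Hc] i fin] by auto
  have "card (common_zeros H) \<le> card ?Z"
    using Z by (intro card_mono) (auto simp: common_zeros_def)
  also have "\<dots> \<le> (2 - i) * d"
    using Z H i2 by (auto simp: cofactors_def intro: order_trans)
  also have "\<dots> \<le> 2 * d" by simp
  finally show ?thesis .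
qed

text \<open>A set of \<open>2 * d + 1\<close> points determines the constant coefficient of a cofactor. As that
  coefficient vanishes on \<^term>\<open>common_zeros H\<close>, these places are free to store the values of \<open>w\<close>.\<close>

lemma card_cofactors_with_values:
  assumes fin: "finite (carrier R)" and d: "2 * d + 1 \<le> card (carrier R)"
  shows "finite (SIGMA H:cofactors d. common_zeros H \<rightarrow>\<^sub>E carrier R)"
    and "card (SIGMA H:cofactors d. common_zeros H \<rightarrow>\<^sub>E carrier R)
      \<le> 2 ^ card (carrier R) * card (carrier R) ^ (3 * d + 3)"
proof -
  let ?A = "carrier R"
  define S where "S = (SIGMA H:cofactors d. common_zeros H \<rightarrow>\<^sub>E ?A)"
  define Z where "Z = {Z. Z \<subseteq> ?A \<and> card Z \<le> 2 * d}"
  \<comment> \<open>\<open>W\<close> depends on the zero set alone, so a decoder that knows the zero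
    set also knows the evaluation points. Their number 2d + 1 exceeds the degree 2d allowed for the
    constant coefficient.\<close>
  have "\<exists>W. Z' \<subseteq> W \<and> W \<subseteq> ?A \<and> card W = 2 * d + 1" if "Z' \<in> Z" for Z'
    using exists_subset_between[of Z' "2 * d + 1" ?A] that fin d by (auto simp: Z_def)
  then obtain W where W: "\<And>Z'. Z' \<in> Z \<Longrightarrow> Z' \<subseteq> W Z' \<and> W Z' \<subseteq> ?A \<and> card (W Z') = 2 * d + 1"
    by metis
  have zZ: "common_zeros H \<in> Z" if "H \<in> cofactors d" for H
    using card_common_zeros[OF fin that] by (auto simp: Z_def common_zeros_def)
  \<comment> \<open>The code space: d + 1 coefficients for h_1, one for h_2, at most 2^q zero sets,
    and 2d + 1 stored values. The exponents of q add up to 3d + 3.\<close>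
  define T where "T = {f \<in> carrier P. deg R f < Suc d} \<times> {f \<in> carrier P. deg R f < 1} \<times>
    (SIGMA Z':Z. W Z' \<rightarrow>\<^sub>E ?A)"
  \<comment> \<open>On the chosen points, values of h_0 are stored outside the zero set and values
    of \<open>w\<close> inside it, where h_0 is known to be 0.\<close>
  define enc where "enc = (\<lambda>(H, w). (coeff (UP P) H 1, coeff (UP P) H 2, common_zeros H,
    \<lambda>\<alpha>\<in>W (common_zeros H). if \<alpha> \<in> common_zeros H then w \<alpha> else eval R R id \<alpha> (coeff (UP P) H 0)))"
  have fZ: "finite Z" using fin by (auto simp: Z_def)
  have cZ: "card Z \<le> 2 ^ card ?A"
    using card_mono[of "Pow ?A" Z] fin by (auto simp: Z_def card_Pow)
  have fW: "finite (W Z')" "finite (W Z' \<rightarrow>\<^sub>E ?A)" "card (W Z' \<rightarrow>\<^sub>E ?A) = card ?A ^ (2 * d + 1)"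
    if "Z' \<in> Z" for Z'
  proof -
    show "finite (W Z')" using W[OF that] fin finite_subset by blast
    then show "finite (W Z' \<rightarrow>\<^sub>E ?A)" "card (W Z' \<rightarrow>\<^sub>E ?A) = card ?A ^ (2 * d + 1)"
      using W[OF that] fin by (auto intro: finite_PiE simp: card_PiE)
  qed
  have fT: "finite T"
    unfolding T_def by (intro finite_cartesian_product finite_SigmaI card_deg_less(1) fin fZ fW(2))
  have "card (SIGMA Z':Z. W Z' \<rightarrow>\<^sub>E ?A) = card Z * card ?A ^ (2 * d + 1)"
    using fZ fW by (subst card_SigmaI) auto
  then have "card T \<le> card ?A ^ Suc d * (card ?A ^ 1 * (2 ^ card ?A * card ?A ^ (2 * d + 1)))"
    unfolding T_def card_cartesian_product
    using card_deg_less(2)[OF fin, of "Suc d"] card_deg_less(2)[OF fin, of 1] cZ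
    by (intro mult_le_mono) (assumption | simp only: mult_le_mono1)+
  also have "\<dots> = 2 ^ card ?A * card ?A ^ (Suc d + (1 + (2 * d + 1)))"
    by (simp only: power_add mult.left_commute)
  also have "Suc d + (1 + (2 * d + 1)) = 3 * d + 3" by simp
  finally have cT: "card T \<le> 2 ^ card ?A * card ?A ^ (3 * d + 3)" .
  have sub: "enc ` S \<subseteq> T"
  proof
    fix x assume "x \<in> enc ` S"
    then obtain H w where x: "x = enc (H, w)" and H: "H \<in> cofactors d"
      and w: "w \<in> common_zeros H \<rightarrow>\<^sub>E ?A" by (auto simp: S_def)
    have Hc: "H \<in> carrier (UP P)" and deg: "\<And>i. i \<le> 2 \<Longrightarrow> deg R (coeff (UP P) H i) \<le> (2 - i) * d"
      using H by (auto simp: cofactors_def)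
    have "deg R (coeff (UP P) H 1) \<le> d" "deg R (coeff (UP P) H 2) \<le> 0"
      using deg[of 1] deg[of 2] by simp_all
    moreover have "coeff (UP P) H i \<in> carrier P" for i
      using Hc by simp
    moreover have "(if \<alpha> \<in> common_zeros H then w \<alpha> else eval R R id \<alpha> (coeff (UP P) H 0)) \<in> ?A"
      if "\<alpha> \<in> W (common_zeros H)" for \<alpha>
      using W[OF zZ[OF H]] that w eval_in_carrier[of \<alpha> "coeff (UP P) H 0"] PP.coeff_closed[OF Hc] by auto
    ultimately show "x \<in> T"
      using zZ[OF H] by (simp add: x enc_def T_def restrict_PiE_iff)
  qed
  have inj: "inj_on enc S"
  proof (rule inj_onI)
    fix x y assume xS: "x \<in> S" and yS: "y \<in> S" and eq: "enc x = enc y"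
    obtain H w where x: "x = (H, w)" and H: "H \<in> cofactors d"
      and w: "w \<in> common_zeros H \<rightarrow>\<^sub>E ?A" using xS by (auto simp: S_def)
    obtain H' w' where y: "y = (H', w')" and H': "H' \<in> cofactors d"
      and w': "w' \<in> common_zeros H' \<rightarrow>\<^sub>E ?A" using yS by (auto simp: S_def)
    have z: "common_zeros H' = common_zeros H"
      and c: "coeff (UP P) H 1 = coeff (UP P) H' 1" "coeff (UP P) H 2 = coeff (UP P) H' 2"
      using eq by (simp_all add: x y enc_def)
    let ?Z = "common_zeros H"
    have val: "(if \<alpha> \<in> ?Z then w \<alpha> else eval R R id \<alpha> (coeff (UP P) H 0)) =
        (if \<alpha> \<in> ?Z then w' \<alpha> else eval R R id \<alpha> (coeff (UP P) H' 0))" if "\<alpha> \<in> W ?Z" for \<alpha>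
    proof -
      have "snd (snd (snd (enc x))) \<alpha> = snd (snd (snd (enc y))) \<alpha>"
        using eq by simp
      then show ?thesis
        using that by (simp add: x y enc_def z)
    qed
    have Hc: "H \<in> carrier (UP P)" "H' \<in> carrier (UP P)"
      and deg: "deg R (coeff (UP P) H 0) \<le> 2 * d" "deg R (coeff (UP P) H' 0) \<le> 2 * d"
      using H H' by (auto simp: cofactors_def)
    have "coeff (UP P) H 0 = coeff (UP P) H' 0"
    proof (rule eq_if_agree_on_many[OF fin])
      show "W ?Z \<subseteq> ?A" using W[OF zZ[OF H]] by simp
      show "deg R (coeff (UP P) H 0) < card (W ?Z)" "deg R (coeff (UP P) H' 0) < card (W ?Z)"
        using W[OF zZ[OF H]] deg by auto
      show "coeff (UP P) H 0 \<in> carrier P" "coeff (UP P) H' 0 \<in> carrier P"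
        using Hc by auto
      fix \<alpha> assume \<alpha>: "\<alpha> \<in> W ?Z"
      show "eval R R id \<alpha> (coeff (UP P) H 0) = eval R R id \<alpha> (coeff (UP P) H' 0)"
      \<comment> \<open>Inside the common zero set the code holds \<open>w\<close>, but both
        constant coefficients vanish there; outside it the code holds their values.\<close>
      proof (cases "\<alpha> \<in> ?Z")
        case True
        then have "\<alpha> \<in> common_zeros H" "\<alpha> \<in> common_zeros H'" using z by auto
        then show ?thesis by (simp add: common_zeros_def)
      next
        case False
        then show ?thesis using val[OF \<alpha>] by simp
      qed
    qed
    then have cc: "coeff (UP P) H i = coeff (UP P) H' i" for i
      using c coeff_cofactor_0[OF H, of i] coeff_cofactor_0[OF H', of i]
      by (cases "2 < i") (auto simp: not_less le_Suc_eq numeral_2_eq_2)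
    then have "H = H'"
      using Hc by (auto intro: PP.up_eqI)
    moreover have "w = w'"
    proof (rule PiE_ext[OF w])
      show "w' \<in> ?Z \<rightarrow>\<^sub>E ?A" using w' z by simp
      show "w \<alpha> = w' \<alpha>" if "\<alpha> \<in> ?Z" for \<alpha>
        using val[of \<alpha>] W[OF zZ[OF H]] that by auto
    qed
    ultimately show "x = y" by (simp add: x y)
  qed
  show "finite (SIGMA H:cofactors d. common_zeros H \<rightarrow>\<^sub>E ?A)"
    using inj_on_finite[OF inj sub fT] by (simp add: S_def)
  show "card (SIGMA H:cofactors d. common_zeros H \<rightarrow>\<^sub>E ?A) \<le> 2 ^ card ?A * card ?A ^ (3 * d + 3)"
    using card_inj_on_le[OF inj sub fT] cT by (simp add: S_def)
qed

section \<open>Counting the functions g\<close>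

text \<open>The functions are covered by boxes \<open>F x\<close>, where \<open>x\<close> consists
  of the two factors, the cofactor and the values of g on its common zeros. A box leaves one choice
  on the common zeros and at most four elsewhere, hence at most 4^q functions; the factor 2^q in the
  number of boxes raises this to 8^q. The bound 2k \<le> q leaves room for the 2(k - 1) + 1 points
  of the encoding.\<close>

lemma card_sudan_multiple_factors:
  assumes fin: "finite (carrier R)" and k: "0 < k" "2 * k \<le> card (carrier R)"
  shows "card {g \<in> carrier R \<rightarrow>\<^sub>E carrier R. \<exists>G. sudan_poly R k g G \<and> has_multiple_factors R k G}
    \<le> 8 ^ card (carrier R) * card (carrier R) ^ (5 * k)"
    (is "card ?S \<le> _")
proof -
  let ?A = "carrier R"
  define L where "L = {f \<in> carrier P. deg R f < k}"
  define D where "D = (SIGMA H:cofactors (k - 1). common_zeros H \<rightarrow>\<^sub>E ?A)"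
  define X where "X = L \<times> L \<times> D"
  define roots where "roots = (\<lambda>f1 f2 H \<alpha>. {eval R R id \<alpha> f1, eval R R id \<alpha> f2} \<union>
    {\<beta> \<in> ?A. bieval R \<alpha> \<beta> H = \<zero>})"
  define F where "F = (\<lambda>(f1, f2, H, w). \<Pi>\<^sub>E \<alpha>\<in>?A. if \<alpha> \<in> common_zeros H then {w \<alpha>} else roots f1 f2 H \<alpha>)"
  have "?S \<subseteq> (\<Union>x\<in>X. F x)"
  proof
    fix g assume "g \<in> ?S"
    then obtain G where g: "g \<in> ?A \<rightarrow>\<^sub>E ?A" and G: "sudan_poly R k g G" "has_multiple_factors R k G"
      by blast
    obtain f1 f2 H where f: "f1 \<in> carrier P" "deg R f1 < k" "f2 \<in> carrier P" "deg R f2 < k"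
      and H: "H \<in> cofactors (k - 1)"
      and r: "\<And>\<alpha>. \<alpha> \<in> ?A \<Longrightarrow> g \<alpha> \<in> ?A \<Longrightarrow>
        g \<alpha> = eval R R id \<alpha> f1 \<or> g \<alpha> = eval R R id \<alpha> f2 \<or> bieval R \<alpha> (g \<alpha>) H = \<zero>"
      by (rule sudan_poly_cofactor[OF G]) (rule that)
    define w where "w = restrict g (common_zeros H)"
    have "common_zeros H \<subseteq> ?A" by (auto simp: common_zeros_def)
    then have "w \<in> common_zeros H \<rightarrow>\<^sub>E ?A" using g by (auto simp: w_def)
    then have X: "(f1, f2, H, w) \<in> X" using f H by (simp add: X_def L_def D_def)
    have "g \<alpha> \<in> (if \<alpha> \<in> common_zeros H then {w \<alpha>} else roots f1 f2 H \<alpha>)" if "\<alpha> \<in> ?A" for \<alpha>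
      using r[OF that] g that by (auto simp: roots_def w_def)
    then have "g \<in> F (f1, f2, H, w)"
      using g unfolding F_def by (auto simp: PiE_iff)
    with X show "g \<in> (\<Union>x\<in>X. F x)" by blast
  qed
  moreover have cF: "finite (F x) \<and> card (F x) \<le> 4 ^ card ?A" if "x \<in> X" for x
  proof -
    obtain f1 f2 H w where x: "x = (f1, f2, H, w)" and H: "H \<in> cofactors (k - 1)"
      using \<open>x \<in> X\<close> by (auto simp: X_def D_def)
    have fr: "finite (roots f1 f2 H \<alpha>)" for \<alpha> using fin by (simp add: roots_def)
    have "card (roots f1 f2 H \<alpha>) \<le> 4" if \<alpha>: "\<alpha> \<in> ?A" "\<alpha> \<notin> common_zeros H" for \<alpha>
    proof -
      obtain i where "eval R R id \<alpha> (coeff (UP P) H i) \<noteq> \<zero>"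
        using \<alpha> by (auto simp: common_zeros_def)
      then have "card {\<beta> \<in> ?A. bieval R \<alpha> \<beta> H = \<zero>} \<le> 2"
        using card_bieval_roots[OF fin \<alpha>(1), of H 2] H by (auto simp: cofactors_def)
      moreover have "card {eval R R id \<alpha> f1, eval R R id \<alpha> f2} \<le> 2"
        by (simp add: card_insert_if)
      ultimately show ?thesis
        unfolding roots_def
        using card_Un_le[of "{eval R R id \<alpha> f1, eval R R id \<alpha> f2}" "{\<beta> \<in> ?A. bieval R \<alpha> \<beta> H = \<zero>}"]
        by linarith
    qed
    then have "card (F x) \<le> (\<Prod>\<alpha>\<in>?A. 4)"
      unfolding x F_def prod.case card_PiE[OF fin] by (intro prod_mono) auto
    then show ?thesis
      unfolding x F_def using fin fr by (auto intro!: finite_PiE)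
  qed
  moreover have fX: "finite X"
    using card_deg_less(1)[OF fin] card_cofactors_with_values(1)[OF fin] k
    unfolding X_def L_def D_def by auto
  ultimately have "card ?S \<le> card (\<Union>x\<in>X. F x)"
    by (intro card_mono) auto
  also have "\<dots> \<le> (\<Sum>x\<in>X. card (F x))" using card_UN_le[OF fX] .
  also have "\<dots> \<le> card X * 4 ^ card ?A" using sum_bounded_above[of X "\<lambda>x. card (F x)"] cF by simp
  also have "card X \<le> card ?A ^ k * (card ?A ^ k * (2 ^ card ?A * card ?A ^ (3 * (k - 1) + 3)))"
    unfolding X_def card_cartesian_product L_def D_def
    using card_deg_less(2)[OF fin] card_cofactors_with_values(2)[OF fin, of "k - 1"] k
    by (intro mult_le_mono) auto
  also have "\<dots> = 2 ^ card ?A * card ?A ^ (k + (k + (3 * (k - 1) + 3)))"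
    by (simp only: power_add mult.left_commute)
  \<comment> \<open>Positivity of \<open>k\<close> matters here because the subtraction is
    truncated.\<close>
  also have "k + (k + (3 * (k - 1) + 3)) = 5 * k" using k by simp
  finally have "card ?S \<le> 2 ^ card ?A * card ?A ^ (5 * k) * 4 ^ card ?A"
    by simp
  moreover have "(8 :: nat) ^ card ?A = 2 ^ card ?A * 4 ^ card ?A"
    by (simp flip: power_mult_distrib)
  ultimately show ?thesis
    by (simp add: mult_ac)
qed

end

section \<open>Asymptotic form of the bound\<close>

theorem theorem5p3:
  shows "\<exists>e :: nat \<Rightarrow> real. e \<in> o(\<lambda>q. real q) \<and>
    (\<forall>(q :: nat) (k :: nat) (R :: 'a ring).
       primepow q \<longrightarrow> field R \<longrightarrow> finite (carrier R) \<longrightarrow> order R = q \<longrightarrow>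
       (real q + 5) / 10 < real k \<longrightarrow> real k < real q / 8 \<longrightarrow>
       real (card {g \<in> carrier R \<rightarrow>\<^sub>E carrier R.
           (\<exists>f\<in>reed_solomon R k. real (hamming_dist R f g) \<le> real q / 2) \<and>
           (\<exists>G. sudan_poly R k g G \<and> has_multiple_factors R k G)})
         \<le> real q powr (5 * real k + e q))"
\<comment> \<open>The witness is the exponent that turns 8^q into a power of q.\<close>
proof (intro exI[of _ "\<lambda>q. real q * ln 8 / ln (real q)"] conjI allI impI)
  show "(\<lambda>q. real q * ln 8 / ln (real q)) \<in> o(\<lambda>q. real q)"
    by real_asymp
  fix q k :: nat and R :: "'a ring"
  assume R: "field R" "finite (carrier R)" "order R = q"
    and k: "(real q + 5) / 10 < real k" "real k < real q / 8"
  interpret field R by fact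
  interpret UP_domain R "UP R" by unfold_locales
  \<comment> \<open>The lower bound on \<open>k\<close> makes it positive, and then k < q/8 forces q
    > 8 as well as 2k \<le> q.\<close>
  have q: "1 < q" "card (carrier R) = q" and k': "0 < k" "2 * k \<le> q"
    using k R(3) by (auto simp: order_def)
  let ?S = "{g \<in> carrier R \<rightarrow>\<^sub>E carrier R.
           (\<exists>f\<in>reed_solomon R k. real (hamming_dist R f g) \<le> real q / 2) \<and>
           (\<exists>G. sudan_poly R k g G \<and> has_multiple_factors R k G)}"
  let ?T = "{g \<in> carrier R \<rightarrow>\<^sub>E carrier R. \<exists>G. sudan_poly R k g G \<and> has_multiple_factors R k G}"
  have "finite ?T"
    using finite_PiE[OF R(2), of "\<lambda>_. carrier R"] R(2) by (auto intro: finite_subset)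
  then have "card ?S \<le> card ?T"
    by (intro card_mono) auto
  also have "\<dots> \<le> 8 ^ q * q ^ (5 * k)"
    using card_sudan_multiple_factors[OF R(2) k'(1)] k' q by simp
  finally have "real (card ?S) \<le> real (8 ^ q * q ^ (5 * k))"
    by (simp only: of_nat_le_iff)
  also have "\<dots> = 8 ^ q * real q ^ (5 * k)"
    by simp
  also have "(8 :: real) ^ q = real q powr (real q * ln 8 / ln (real q))"
  proof -
    have "ln (real q) \<noteq> 0" using q by simp
    then have "real q powr (real q * ln 8 / ln (real q)) = exp (real q * ln 8)"
      using q by (simp add: powr_def)
    then show ?thesis by (simp add: exp_of_nat_mult)
  qed
  also have "real q ^ (5 * k) = real q powr (5 * real k)"
    using q powr_realpow[of "real q" "5 * k"] by simp
  finally show "real (card ?S) \<le> real q powr (5 * real k + real q * ln 8 / ln (real q))"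
    by (simp add: powr_add mult.commute)
qed

end
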